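(* For a sequence $\gamma=\{\gamma_k\}_{k\in\mathbb{N}}$ of non-negative reals with $\gamma_k\to0$, let $\mu_\gamma$ denote the associated uniform probability measure on $X$. The following claims hold: (i) For every such $\gamma$: if for $x \in E_\gamma$ there is an $m\in \mathbb{N}$ with $|x_m| = \gamma_m>0$, then $x$ is not a strong mode of $\mu_\gamma$. (ii) There are such a $\gamma \in X$ and an $x \in X$ with $|x_k| < \gamma_k$ for all $k \in \mathbb{N}$ such that $x$ is not a strong mode of $\mu_\gamma$.
   Context: $X := \{x=\{x_k\}_{k\in\mathbb{N}} \in \ell^\infty: \lim_{k\to\infty} x_k = 0\}$ (i.e. $X=c_0$), endowed with the norm $\|x\|_\infty=\sup_k|x_k|$; $e_k$ denotes the $k$-th standard unit vector and $B^\delta(x)$ the open ball of radius $\delta$ around $x$. The measure $\mu_\gamma$ is the law on $X$ of the random variable $\xi := \sum_{k=1}^\infty \gamma_k \xi_k e_k$, where the $\xi_k \sim \mathcal{U}[-1,1]$ are independent and uniformly distributed on $[-1,1]$ (the series converges almost surely in $X$). Further, $E_\gamma := \{x \in X : |x_k| \le \gamma_k \text{ for all } k \in \mathbb{N}\}$. A point $\hat x\in X$ is a (strong) mode of a probability measure $\mu$ on $X$ if $\lim_{\delta\to 0} \mu(B^\delta(\hat x))/M^\delta = 1$, where $M^\delta := \sup_{x\in X}\mu(B^\delta(x))$. *)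

theory Defs
  imports "HOL-Probability.Probability"
begin

text \<open>The Banach space \<open>c\<^sub>0\<close> of real null sequences (automatically bounded), with the supremum norm.\<close>

typedef c0 = "{x :: nat \<Rightarrow> real. x \<longlonglongrightarrow> 0}"
  morphisms coord Abs_c0
  by (rule exI[of _ "\<lambda>_. 0"]) simp

setup_lifting type_definition_c0

lemma coord_tendsto_0: "coord x \<longlonglongrightarrow> 0"
  using coord[of x] by simp

lemma bdd_above_abs_coord: "bdd_above (range (\<lambda>k. \<bar>coord x k\<bar>))"
proof -
  have "Bseq (coord x)"
    using coord_tendsto_0[of x] by (intro convergent_imp_Bseq convergentI)
  then obtain K where "\<And>k. norm (coord x k) \<le> K"
    by (auto simp: Bseq_def)
  then show ?thesis
    by (auto intro!: bdd_aboveI[of _ K])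
qed

instantiation c0 :: real_vector
begin

lift_definition zero_c0 :: c0 is "\<lambda>_. 0" by simp

lift_definition plus_c0 :: "c0 \<Rightarrow> c0 \<Rightarrow> c0" is "\<lambda>x y k. x k + y k"
  using tendsto_add by fastforce

lift_definition minus_c0 :: "c0 \<Rightarrow> c0 \<Rightarrow> c0" is "\<lambda>x y k. x k - y k"
  using tendsto_diff by fastforce

lift_definition uminus_c0 :: "c0 \<Rightarrow> c0" is "\<lambda>x k. - x k"
  using tendsto_minus by fastforce

lift_definition scaleR_c0 :: "real \<Rightarrow> c0 \<Rightarrow> c0" is "\<lambda>a x k. a * x k"
  by (auto intro: tendsto_mult_right_zero)

instance
proof
  fix x y z :: c0 and a b :: real
  show "x + y + z = x + (y + z)" "x + y = y + x" "0 + x = x" "- x + x = 0" "x - y = x + - y"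
    "a *\<^sub>R (x + y) = a *\<^sub>R x + a *\<^sub>R y" "(a + b) *\<^sub>R x = a *\<^sub>R x + b *\<^sub>R x"
    "a *\<^sub>R b *\<^sub>R x = (a * b) *\<^sub>R x" "1 *\<^sub>R x = x"
    by (transfer; simp add: algebra_simps)+
qed

end

instantiation c0 :: real_normed_vector
begin

definition norm_c0 :: "c0 \<Rightarrow> real"
  where "norm_c0 x = (SUP k. \<bar>coord x k\<bar>)"

definition sgn_c0 :: "c0 \<Rightarrow> c0"
  where "sgn_c0 x = x /\<^sub>R norm x"

definition dist_c0 :: "c0 \<Rightarrow> c0 \<Rightarrow> real"
  where "dist_c0 x y = norm (x - y)"

definition uniformity_c0 :: "(c0 \<times> c0) filter"
  where "uniformity_c0 = (INF e\<in>{0 <..}. principal {(x, y). dist x y < e})"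

definition open_c0 :: "c0 set \<Rightarrow> bool"
  where "open_c0 S = (\<forall>x\<in>S. \<forall>\<^sub>F (x', y) in uniformity. x' = x \<longrightarrow> y \<in> S)"

instance
proof
  fix x y :: c0 and a :: real
  have abs_le: "\<bar>coord x k\<bar> \<le> norm x" for x :: c0 and k
    unfolding norm_c0_def by (intro cSUP_upper bdd_above_abs_coord) simp
  show "norm x = 0 \<longleftrightarrow> x = 0"
  proof
    assume "norm x = 0"
    then have "coord x k = 0" for k
      using abs_le[of x k] by simp
    then show "x = 0"
      by transfer auto
  qed (simp add: norm_c0_def zero_c0.rep_eq)
  show "norm (x + y) \<le> norm x + norm y"
    unfolding norm_c0_def[of "x + y"]
  proof (rule cSUP_least)
    fix k
    show "\<bar>coord (x + y) k\<bar> \<le> norm x + norm y"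
      using abs_le[of x k] abs_le[of y k] by (simp add: plus_c0.rep_eq)
  qed simp
  have scale_le: "norm (a *\<^sub>R x) \<le> \<bar>a\<bar> * norm x" for a and x :: c0
    unfolding norm_c0_def[of "a *\<^sub>R x"]
    by (rule cSUP_least) (auto simp: scaleR_c0.rep_eq abs_mult intro!: mult_left_mono abs_le)
  show "norm (a *\<^sub>R x) = \<bar>a\<bar> * norm x"
  proof (cases "a = 0")
    case True
    then have "a *\<^sub>R x = 0" by (transfer) simp
    then show ?thesis
      using True by (simp add: norm_c0_def zero_c0.rep_eq)
  next
    case False
    have "x = inverse a *\<^sub>R (a *\<^sub>R x)"
      using False by transfer (simp add: field_simps)
    then have "norm x \<le> \<bar>inverse a\<bar> * norm (a *\<^sub>R x)"
      using scale_le[of "inverse a" "a *\<^sub>R x"] by simp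
    then have "\<bar>a\<bar> * norm x \<le> norm (a *\<^sub>R x)"
      using False by (simp add: field_simps abs_mult split: if_splits)
    then show ?thesis
      using scale_le[of a x] by simp
  qed
qed (simp_all add: dist_c0_def sgn_c0_def uniformity_c0_def open_c0_def)

end

lemma abs_coord_le_norm: "\<bar>coord x k\<bar> \<le> norm x"
  unfolding norm_c0_def by (intro cSUP_upper bdd_above_abs_coord) simp

lemma norm_c0_le_iff: "norm x \<le> r \<longleftrightarrow> (\<forall>k. \<bar>coord x k\<bar> \<le> r)"
proof
  assume "\<forall>k. \<bar>coord x k\<bar> \<le> r"
  then show "norm x \<le> r"
    unfolding norm_c0_def by (intro cSUP_least) auto
qed (use abs_coord_le_norm order_trans in blast)

lift_definition unit_c0 :: "nat \<Rightarrow> c0" is "\<lambda>k i. if i = k then 1 else 0"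
proof -
  fix k :: nat
  have "eventually (\<lambda>i. (if i = k then 1 else 0 :: real) = 0) sequentially"
    using eventually_gt_at_top[of k] by eventually_elim simp
  then show "(\<lambda>i. if i = k then 1 else 0 :: real) \<longlonglongrightarrow> 0"
    by (rule tendsto_eventually)
qed

text \<open>The common law of all coordinate variables: a countable product of \<open>\<U>[-1,1]\<close>.\<close>

definition unif_seq :: "(nat \<Rightarrow> real) measure"
  where "unif_seq = (\<Pi>\<^sub>M k\<in>UNIV. uniform_measure lborel {-1..1})"

text \<open>
  The series is taken in the norm of \<open>c\<^sub>0\<close>. Where it diverges (a null set if \<open>\<gamma>\<close> tends to 0), its value
  is an unspecified constant.
\<close>

definition random_series :: "(nat \<Rightarrow> real) \<Rightarrow> (nat \<Rightarrow> real) \<Rightarrow> c0"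
  where "random_series \<gamma> \<omega> = (\<Sum>k. (\<gamma> k * \<omega> k) *\<^sub>R unit_c0 k)"

definition uniform_c0 :: "(nat \<Rightarrow> real) \<Rightarrow> c0 measure"
  where "uniform_c0 \<gamma> = distr unif_seq borel (random_series \<gamma>)"

definition E_box :: "(nat \<Rightarrow> real) \<Rightarrow> c0 set"
  where "E_box \<gamma> = {x. \<forall>k. \<bar>coord x k\<bar> \<le> \<gamma> k}"

definition strong_mode :: "'a::metric_space measure \<Rightarrow> 'a \<Rightarrow> bool"
  where "strong_mode \<mu> x \<longleftrightarrow>
    ((\<lambda>\<delta>. measure \<mu> (ball x \<delta>) / (SUP y. measure \<mu> (ball y \<delta>))) \<longlongrightarrow> 1) (at_right 0)"

subsection \<open>Well-definedness of the measure\<close>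

lemma prob_space_unif: "prob_space (uniform_measure lborel {-1..1::real})"
  by (rule prob_space_uniform_measure) simp_all

lemma prob_space_unif_seq: "prob_space unif_seq"
  unfolding unif_seq_def by (intro prob_space_PiM prob_space_unif)

lemma coord_sum_unit:
  "coord (\<Sum>k<n. a k *\<^sub>R unit_c0 k) i = (if i < n then a i else 0)"
proof (induction n)
  case (Suc n)
  then show ?case
    by (auto simp: plus_c0.rep_eq scaleR_c0.rep_eq unit_c0.rep_eq less_Suc_eq)
qed (simp add: zero_c0.rep_eq)

lemma series_sums:
  assumes "a \<longlonglongrightarrow> 0"
  shows "(\<lambda>k. a k *\<^sub>R unit_c0 k) sums Abs_c0 a"
  unfolding sums_def
proof (rule LIMSEQ_I)
  fix r :: real
  assume r: "r > 0"
  then obtain N where N: "\<And>k. k \<ge> N \<Longrightarrow> \<bar>a k\<bar> < r / 2"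
    using LIMSEQ_D[OF assms, of "r / 2"] by auto
  have c: "coord (Abs_c0 a) = a"
    using assms by (simp add: Abs_c0_inverse)
  have "norm ((\<Sum>k<n. a k *\<^sub>R unit_c0 k) - Abs_c0 a) \<le> r / 2" if "n \<ge> N" for n
    unfolding norm_c0_le_iff
    using N r that by (auto simp: minus_c0.rep_eq coord_sum_unit c less_imp_le)
  then show "\<exists>no. \<forall>n\<ge>no. norm ((\<Sum>k<n. a k *\<^sub>R unit_c0 k) - Abs_c0 a) < r"
    using r by (intro exI[of _ N]) force
qed

lemma series_summable_iff: "summable (\<lambda>k. a k *\<^sub>R unit_c0 k) \<longleftrightarrow> a \<longlonglongrightarrow> 0"
proof
  assume "summable (\<lambda>k. a k *\<^sub>R unit_c0 k)"
  then have *: "(\<lambda>k. a k *\<^sub>R unit_c0 k) \<longlonglongrightarrow> 0"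
    by (rule summable_LIMSEQ_zero)
  have le: "norm (a k) \<le> norm (a k *\<^sub>R unit_c0 k)" for k
    using abs_coord_le_norm[of "a k *\<^sub>R unit_c0 k" k]
    by (simp add: scaleR_c0.rep_eq unit_c0.rep_eq)
  show "a \<longlonglongrightarrow> 0"
    by (rule Lim_null_comparison[OF _ tendsto_norm_zero[OF *]]) (use le in auto)
qed (use series_sums sums_summable in blast)

lemma AE_unif_seq: "AE \<omega> in unif_seq. \<forall>k. \<bar>\<omega> k\<bar> \<le> 1"
proof -
  have "AE x in uniform_measure lborel {-1..1::real}. \<bar>x\<bar> \<le> 1"
    by (rule AE_uniform_measureI) auto
  then have "AE \<omega> in unif_seq. \<bar>\<omega> k\<bar> \<le> 1" for k
    unfolding unif_seq_def by (intro AE_PiM_component prob_space_unif) auto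
  then show ?thesis
    by (simp add: AE_all_countable)
qed

lemma AE_series_summable:
  assumes "\<gamma> \<longlonglongrightarrow> 0"
  shows "AE \<omega> in unif_seq. summable (\<lambda>k. (\<gamma> k * \<omega> k) *\<^sub>R unit_c0 k)"
  using AE_unif_seq
proof eventually_elim
  case (elim \<omega>)
  have "norm (\<gamma> k * \<omega> k) \<le> norm (\<gamma> k)" for k
    using mult_left_mono[of "\<bar>\<omega> k\<bar>" 1 "\<bar>\<gamma> k\<bar>"] elim by (simp add: abs_mult)
  then have "(\<lambda>k. \<gamma> k * \<omega> k) \<longlonglongrightarrow> 0"
    using assms by (intro Lim_null_comparison[OF _ tendsto_norm_zero[OF assms]]) auto
  then show ?case
    by (simp add: series_summable_iff)
qed

lemma borel_measurable_c0:
  assumes [measurable]: "\<And>k. (\<lambda>\<omega>. coord (f \<omega>) k) \<in> borel_measurable M"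
  shows "f \<in> borel_measurable M"
proof (rule borel_measurableI)
  fix U :: "c0 set"
  assume U: "open U"
  define d where "d l = (\<Sum>k<length l. (of_rat (l ! k) :: real) *\<^sub>R unit_c0 k)" for l :: "rat list"
  define I where "I = {(l, q). cball (d l) (of_rat q) \<subseteq> U}"
  have "\<exists>(l, q)\<in>I. x \<in> cball (d l) (of_rat q)" if x: "x \<in> U" for x
  proof -
    obtain e where e: "e > 0" "ball x e \<subseteq> U"
      using U x by (auto simp: open_contains_ball)
    obtain q where q: "0 < real_of_rat q" "real_of_rat q < e / 2"
      using of_rat_dense[of 0 "e / 2"] e by auto
    obtain N where N: "\<And>k. k \<ge> N \<Longrightarrow> \<bar>coord x k\<bar> < of_rat q"
      using LIMSEQ_D[OF coord_tendsto_0[of x] q(1)] by auto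
    have "\<exists>r. \<bar>real_of_rat r - coord x k\<bar> \<le> of_rat q" for k
    proof -
      obtain r where "coord x k < of_rat r" "of_rat r < coord x k + of_rat q"
        using of_rat_dense[of "coord x k" "coord x k + of_rat q"] q by auto
      then show ?thesis
        by (intro exI[of _ r]) simp
    qed
    then obtain r where r: "\<And>k. \<bar>real_of_rat (r k) - coord x k\<bar> \<le> of_rat q"
      by metis
    define l where "l = map r [0..<N]"
    have "norm (d l - x) \<le> of_rat q"
      unfolding norm_c0_le_iff
    proof
      fix k
      show "\<bar>coord (d l - x) k\<bar> \<le> of_rat q"
        using N[of k] r[of k]
        by (auto simp: d_def minus_c0.rep_eq coord_sum_unit l_def)
    qed
    then have *: "dist (d l) x \<le> of_rat q"
      by (simp add: dist_norm)
    have "cball (d l) (of_rat q) \<subseteq> ball x e"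
    proof
      fix y assume "y \<in> cball (d l) (of_rat q)"
      then show "y \<in> ball x e"
        using dist_triangle3[of x y "d l"] * q by simp
    qed
    with e * show ?thesis
      by (auto simp: I_def)
  qed
  then have U_eq: "U = (\<Union>(l, q)\<in>I. cball (d l) (of_rat q))"
    by (auto simp: I_def)
  have "f -` cball (d l) r \<inter> space M
      = {\<omega> \<in> space M. \<forall>k. \<bar>coord (d l) k - coord (f \<omega>) k\<bar> \<le> r}" for l r
    by (auto simp: dist_norm norm_c0_le_iff minus_c0.rep_eq)
  then have "f -` cball (d l) r \<inter> space M \<in> sets M" for l r
    by simp
  then have "(\<Union>(l, q)\<in>I. f -` cball (d l) (of_rat q) \<inter> space M) \<in> sets M"
    by (intro sets.countable_UN') auto
  moreover have "f -` U \<inter> space M = (\<Union>(l, q)\<in>I. f -` cball (d l) (of_rat q) \<inter> space M)"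
    by (subst U_eq) auto
  ultimately show "f -` U \<inter> space M \<in> sets M"
    by simp
qed

lemma measurable_random_series: "random_series \<gamma> \<in> borel_measurable unif_seq"
proof (rule borel_measurable_c0)
  fix k
  define c where "c = (THE s :: c0. False)"
  have [measurable]: "(\<lambda>\<omega>. \<omega> i) \<in> borel_measurable unif_seq" for i
  proof -
    have "(\<lambda>\<omega>. \<omega> i) \<in> measurable unif_seq (uniform_measure lborel {-1..1::real})"
      unfolding unif_seq_def by (rule measurable_component_singleton) simp
    then show ?thesis
      by (simp cong: measurable_cong_sets)
  qed
  have eq: "random_series \<gamma> \<omega> = (if (\<lambda>i. \<gamma> i * \<omega> i) \<longlonglongrightarrow> 0 then Abs_c0 (\<lambda>i. \<gamma> i * \<omega> i) else c)" for \<omega>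
  proof (cases "(\<lambda>i. \<gamma> i * \<omega> i) \<longlonglongrightarrow> 0")
    case True
    then show ?thesis
      using series_sums[OF True] by (simp add: random_series_def sums_iff)
  next
    case False
    then have "\<not> (\<lambda>i. (\<gamma> i * \<omega> i) *\<^sub>R unit_c0 i) sums s" for s
      using series_summable_iff sums_summable by metis
    then show ?thesis
      using False by (simp add: random_series_def suminf_def c_def)
  qed
  have "coord (random_series \<gamma> \<omega>) k = (if (\<lambda>i. \<gamma> i * \<omega> i) \<longlonglongrightarrow> 0 then \<gamma> k * \<omega> k else coord c k)" for \<omega>
    by (simp add: eq Abs_c0_inverse)
  then show "(\<lambda>\<omega>. coord (random_series \<gamma> \<omega>) k) \<in> borel_measurable unif_seq"
    by simp
qed

lemma prob_space_uniform_c0: "prob_space (uniform_c0 \<gamma>)"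
  unfolding uniform_c0_def
  by (intro prob_space.prob_space_distr prob_space_unif_seq measurable_random_series)

end

theory Submission
  imports Defs
begin

text \<open>
  A ball of \<open>c\<^sub>0\<close> is a box: a null sequence has norm below \<open>\<delta>\<close> as soon as each of its coordinates
  does (\<open>norm_c0_less_iff\<close>). The coordinates of the random series are independent, so the measure
  of a ball is an infinite product of one-dimensional probabilities (\<open>measure_uniform_c0_ball\<close>,
  \<open>measure_Pi_change_factor\<close>). Moving the centre in a single coordinate \<open>m\<close> therefore changes one
  factor of the product only (\<open>measure_ball_recentre\<close>), and all other coordinates may be ignored.

  That factor is the probability that a uniform variable on \<open>[-1,1]\<close> falls into an interval of
  radius \<open>r = \<delta> / \<gamma>\<^sub>m\<close> around \<open>s = x\<^sub>m / \<gamma>\<^sub>m\<close>. Where the interval sticks out of \<open>[-1,1]\<close>,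
  probability is lost, and for \<open>r \<le> 1\<close> recentring at \<open>s = 0\<close> recovers all of it.

  If \<open>\<bar>x\<^sub>m\<bar> = \<gamma>\<^sub>m\<close>, exactly half of the interval is lost for every \<open>\<delta> \<le> \<gamma>\<^sub>m\<close>, hence the ratio in the
  definition of a mode is at most \<open>1/2\<close> for all small radii. If \<open>x = \<gamma>/2\<close>, each single
  coordinate stops mattering once \<open>\<delta>\<close> is small, but at the radius \<open>\<delta> = \<gamma>\<^sub>n\<close> the coordinate \<open>n\<close> still
  loses a quarter. So the ratio is at most \<open>3/4\<close> along the radii \<open>\<gamma>\<^sub>n\<close>, which tend to 0, and \<open>x\<close> is
  not a mode although it lies strictly inside the box in every coordinate.
\<close>

text \<open>
  A single competing centre per radius refutes a mode, and it may depend on the radius; it is enough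
  that this happens for arbitrarily small radii.
\<close>

lemma not_strong_modeI:
  fixes x :: "'a::metric_space"
  assumes "prob_space \<mu>" and c: "0 \<le> c" "c < 1"
    and freq: "\<exists>\<^sub>F \<delta> in at_right 0. \<exists>y. measure \<mu> (ball x \<delta>) \<le> c * measure \<mu> (ball y \<delta>)"
  shows "\<not> strong_mode \<mu> x"
proof
  interpret prob_space \<mu> by fact
  let ?M = "\<lambda>\<delta>. SUP y. measure \<mu> (ball y \<delta>)"
  assume "strong_mode \<mu> x"
  then have "\<forall>\<^sub>F \<delta> in at_right 0. c < measure \<mu> (ball x \<delta>) / ?M \<delta>"
    unfolding strong_mode_def using c(2) by (rule order_tendstoD(1))
  with freq have "\<exists>\<^sub>F \<delta> in at_right 0. (\<exists>y. measure \<mu> (ball x \<delta>) \<le> c * measure \<mu> (ball y \<delta>))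
      \<and> c < measure \<mu> (ball x \<delta>) / ?M \<delta>"
    by (rule frequently_eventually_frequently)
  then obtain \<delta> y where lt: "c < measure \<mu> (ball x \<delta>) / ?M \<delta>"
    and le: "measure \<mu> (ball x \<delta>) \<le> c * measure \<mu> (ball y \<delta>)"
    by (auto dest: frequently_ex)
  have upper: "measure \<mu> (ball z \<delta>) \<le> ?M \<delta>" for z
    by (rule cSUP_upper) (auto intro!: bdd_aboveI[of _ 1])
  have "0 \<le> ?M \<delta>"
    using upper[of x] measure_nonneg[of \<mu> "ball x \<delta>"] by linarith
  moreover have "measure \<mu> (ball x \<delta>) \<le> c * ?M \<delta>"
    using le mult_left_mono[OF upper[of y] c(1)] by linarith
  ultimately have "measure \<mu> (ball x \<delta>) / ?M \<delta> \<le> c"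
    using c by (cases "?M \<delta> = 0") (auto simp: field_simps)
  with lt show False by simp
qed

text \<open>
  The supremum is attained: outside a finite set the coordinates stay below \<open>r / 2\<close>. Without the
  decay of the coordinates only \<open>norm x \<le> r\<close> would follow.
\<close>

lemma norm_c0_less_iff:
  assumes "0 < r"
  shows "norm x < r \<longleftrightarrow> (\<forall>k. \<bar>coord x k\<bar> < r)"
proof
  assume *: "\<forall>k. \<bar>coord x k\<bar> < r"
  obtain N where N: "\<And>k. k \<ge> N \<Longrightarrow> \<bar>coord x k\<bar> < r / 2"
    using LIMSEQ_D[OF coord_tendsto_0[of x], of "r / 2"] assms by auto
  define b where "b = Max (insert (r / 2) ((\<lambda>k. \<bar>coord x k\<bar>) ` {..<N}))"
  have "b < r"
    unfolding b_def using * assms by (subst Max_less_iff) auto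
  moreover have "\<bar>coord x k\<bar> \<le> b" for k
  proof (cases "k < N")
    case True
    then show ?thesis unfolding b_def by (intro Max_ge) auto
  next
    case False
    then have "\<bar>coord x k\<bar> \<le> r / 2" using N[of k] by simp
    also have "r / 2 \<le> b" unfolding b_def by (intro Max_ge) auto
    finally show ?thesis .
  qed
  ultimately show "norm x < r"
    using norm_c0_le_iff[of x b] by simp
qed (use abs_coord_le_norm le_less_trans in blast)

text \<open>
  The partial products that approximate the two boxes differ in the factor \<open>m\<close> only, and this
  proportionality survives the limit. Stated without division, so that it covers null sets.
\<close>

lemma (in sequence_space) measure_Pi_change_factor:
  assumes E: "\<And>k. E k \<in> sets M" and F: "\<And>k. F k \<in> sets M"
    and same: "\<And>k. k \<noteq> m \<Longrightarrow> E k = F k"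
  shows "measure S (Pi UNIV E) * measure M (F m) = measure S (Pi UNIV F) * measure M (E m)"
proof (rule LIMSEQ_unique)
  let ?p = "\<lambda>A n. \<Prod>i\<le>n. measure M (A i)"
  show "(\<lambda>n. ?p E n * measure M (F m)) \<longlonglongrightarrow> measure S (Pi UNIV E) * measure M (F m)"
    using measure_PiM_countable[of E] E by (intro tendsto_mult_right) auto
  have "(\<lambda>n. ?p F n * measure M (E m)) \<longlonglongrightarrow> measure S (Pi UNIV F) * measure M (E m)"
    using measure_PiM_countable[of F] F by (intro tendsto_mult_right) auto
  moreover have "\<forall>\<^sub>F n in sequentially. ?p F n * measure M (E m) = ?p E n * measure M (F m)"
    using eventually_ge_at_top[of m]
  proof eventually_elim
    case (elim n)
    have split: "?p A n = measure M (A m) * (\<Prod>i\<in>{..n} - {m}. measure M (A i))" for A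
      using elim by (intro prod.remove) auto
    have "(\<Prod>i\<in>{..n} - {m}. measure M (E i)) = (\<Prod>i\<in>{..n} - {m}. measure M (F i))"
      using same by (intro prod.cong) auto
    then show ?case
      by (simp add: split)
  qed
  ultimately show "(\<lambda>n. ?p E n * measure M (F m)) \<longlonglongrightarrow> measure S (Pi UNIV F) * measure M (E m)"
    by (rule Lim_transform_eventually)
qed

interpretation unif: sequence_space "uniform_measure lborel {-1..1::real}"
  by (simp add: sequence_space_def product_prob_space_def product_prob_space_axioms_def
      product_sigma_finite_def prob_space_unif prob_space_imp_sigma_finite)

lemma measure_uniform_interval:
  fixes s r :: real
  assumes "\<bar>s\<bar> \<le> 1" "0 \<le> r"
  shows "measure (uniform_measure lborel {-1..1}) {s - r<..<s + r}
    = (min 1 (s + r) - max (-1) (s - r)) / 2"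
proof -
  define a b where "a = max (-1) (s - r)" and "b = min 1 (s + r)"
  have ab: "a \<le> b" using assms by (auto simp: a_def b_def)
  let ?I = "{-1..1} \<inter> {s - r<..<s + r}"
  \<comment> \<open>which end points belong to the intersection depends on \<open>s\<close> and \<open>r\<close>, but they are null\<close>
  have "{a<..<b} \<subseteq> ?I" "?I \<subseteq> {a..b}"
    by (auto simp: a_def b_def)
  moreover have bounded: "{c..d} \<in> fmeasurable lborel" for c d :: real
    by (rule fmeasurableI) (simp_all add: emeasure_lborel_Icc_eq)
  moreover have "?I \<in> fmeasurable lborel"
    by (rule fmeasurable_Int_fmeasurable[OF bounded]) simp
  ultimately have "measure lborel {a<..<b} \<le> measure lborel ?I"
    "measure lborel ?I \<le> measure lborel {a..b}"
    by (blast intro: measure_mono_fmeasurable fmeasurableD lborelD borel_open open_greaterThanLessThan)+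
  then have "measure lborel ?I = b - a"
    using ab by simp
  then show ?thesis
    by (subst measure_uniform_measure) (auto simp: a_def b_def)
qed

text \<open>
  Almost surely the series converges and its \<open>k\<close>-th coordinate is \<open>\<gamma> k * \<omega> k\<close>, so the ball
  constrains each \<open>\<omega> k\<close> separately.
\<close>

lemma measure_uniform_c0_ball:
  assumes "\<gamma> \<longlonglongrightarrow> 0" "0 < \<delta>"
  shows "measure (uniform_c0 \<gamma>) (ball x \<delta>)
    = measure unif_seq (Pi UNIV (\<lambda>k. {u. \<bar>coord x k - \<gamma> k * u\<bar> < \<delta>}))"
    (is "_ = measure _ ?B")
proof -
  have "measure (uniform_c0 \<gamma>) (ball x \<delta>)
      = measure unif_seq (random_series \<gamma> -` ball x \<delta> \<inter> space unif_seq)"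
    unfolding uniform_c0_def by (rule measure_distr) (auto intro: measurable_random_series)
  also have "\<dots> = measure unif_seq ?B"
  proof (rule measure_eq_AE)
    show "AE \<omega> in unif_seq. \<omega> \<in> random_series \<gamma> -` ball x \<delta> \<inter> space unif_seq \<longleftrightarrow> \<omega> \<in> ?B"
      using AE_series_summable[OF assms(1)] AE_space
    proof eventually_elim
      case (elim \<omega>)
      let ?a = "\<lambda>k. \<gamma> k * \<omega> k"
      have a: "?a \<longlonglongrightarrow> 0"
        using elim by (simp add: series_summable_iff)
      then have "coord (random_series \<gamma> \<omega>) = ?a"
        using series_sums[OF a] by (simp add: random_series_def sums_iff Abs_c0_inverse)
      then show ?case
        using elim assms(2)
        by (auto simp: dist_norm norm_c0_less_iff minus_c0.rep_eq)
    qed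
    show "random_series \<gamma> -` ball x \<delta> \<inter> space unif_seq \<in> sets unif_seq"
      by (rule measurable_sets[OF measurable_random_series]) simp
    show "?B \<in> sets unif_seq"
      unfolding unif_seq_def by (rule unif.infprod_in_sets) simp
  qed
  finally show ?thesis .
qed

text \<open>
  The other coordinates contribute a common factor, which is treated in product form because it can
  vanish: \<open>x\<close> is arbitrary there.
\<close>

lemma measure_ball_recentre:
  fixes \<gamma> :: "nat \<Rightarrow> real" and x :: c0
  assumes \<gamma>: "\<gamma> \<longlonglongrightarrow> 0" "0 < \<gamma> m" and \<delta>: "0 < \<delta>" "\<delta> \<le> \<gamma> m" and x: "\<bar>coord x m\<bar> \<le> \<gamma> m"
  defines "s \<equiv> coord x m / \<gamma> m" and "r \<equiv> \<delta> / \<gamma> m"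
  shows "measure (uniform_c0 \<gamma>) (ball x \<delta>) * r
    = measure (uniform_c0 \<gamma>) (ball (x - coord x m *\<^sub>R unit_c0 m) \<delta>)
      * ((min 1 (s + r) - max (-1) (s - r)) / 2)"
proof -
  let ?U = "uniform_measure lborel {-1..1::real}"
  define y where "y = x - coord x m *\<^sub>R unit_c0 m"
  define B where "B z k = {u. \<bar>coord z k - \<gamma> k * u\<bar> < \<delta>}" for z :: c0 and k
  have y: "coord y k = (if k = m then 0 else coord x k)" for k
    by (simp add: y_def minus_c0.rep_eq scaleR_c0.rep_eq unit_c0.rep_eq)
  have side: "B z m = {coord z m / \<gamma> m - r<..<coord z m / \<gamma> m + r}" for z
    using \<gamma>(2) by (auto simp: B_def r_def field_simps abs_less_iff)
  have "measure unif_seq (Pi UNIV (B x)) * measure ?U (B y m)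
      = measure unif_seq (Pi UNIV (B y)) * measure ?U (B x m)"
    unfolding unif_seq_def by (rule unif.measure_Pi_change_factor) (auto simp: B_def y)
  moreover have "measure ?U (B x m) = (min 1 (s + r) - max (-1) (s - r)) / 2"
    using x \<gamma>(2) \<delta> unfolding side s_def
    by (intro measure_uniform_interval) (auto simp: r_def field_simps abs_le_iff)
  moreover have "measure ?U (B y m) = r"
    using measure_uniform_interval[of 0 r] \<delta> \<gamma>(2) by (simp add: side y r_def)
  moreover have "measure (uniform_c0 \<gamma>) (ball z \<delta>) = measure unif_seq (Pi UNIV (B z))" for z
    unfolding B_def by (rule measure_uniform_c0_ball[OF \<gamma>(1) \<delta>(1)])
  ultimately show ?thesis
    unfolding y_def by metis
qed

text \<open>
  At \<open>s = 1\<close> or \<open>s = -1\<close> only the inner half of the interval carries mass, whatever the radius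
  \<open>r \<le> 1\<close>.
\<close>

lemma not_strong_mode_face:
  fixes \<gamma> :: "nat \<Rightarrow> real" and x :: c0
  assumes "\<gamma> \<longlonglongrightarrow> 0" and m: "\<bar>coord x m\<bar> = \<gamma> m" "0 < \<gamma> m"
  shows "\<not> strong_mode (uniform_c0 \<gamma>) x"
proof (rule not_strong_modeI[of _ "1 / 2"])
  have "measure (uniform_c0 \<gamma>) (ball x \<delta>)
      \<le> 1 / 2 * measure (uniform_c0 \<gamma>) (ball (x - coord x m *\<^sub>R unit_c0 m) \<delta>)"
    if \<delta>: "0 < \<delta>" "\<delta> < \<gamma> m" for \<delta>
  proof -
    have r: "0 < \<delta> / \<gamma> m" "\<delta> / \<gamma> m \<le> 1" using \<delta> by auto
    have "coord x m / \<gamma> m = 1 \<or> coord x m / \<gamma> m = -1"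
      using m by (auto simp: abs_if field_simps split: if_splits)
    then have "(min 1 (coord x m / \<gamma> m + \<delta> / \<gamma> m) - max (-1) (coord x m / \<gamma> m - \<delta> / \<gamma> m)) / 2
        = (\<delta> / \<gamma> m) / 2"
      using r by (elim disjE) (simp_all add: min_def max_def)
    then have "measure (uniform_c0 \<gamma>) (ball x \<delta>) * (\<delta> / \<gamma> m)
        = 1 / 2 * measure (uniform_c0 \<gamma>) (ball (x - coord x m *\<^sub>R unit_c0 m) \<delta>) * (\<delta> / \<gamma> m)"
      using measure_ball_recentre[of \<gamma> m \<delta> x] assms \<delta> by simp
    then show ?thesis
      using r by (subst (asm) mult_cancel_right) auto
  qed
  then have "\<forall>\<^sub>F \<delta> in at_right 0. \<exists>y. measure (uniform_c0 \<gamma>) (ball x \<delta>)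
      \<le> 1 / 2 * measure (uniform_c0 \<gamma>) (ball y \<delta>)"
    using m(2) unfolding eventually_at_right_field by blast
  then show "\<exists>\<^sub>F \<delta> in at_right 0. \<exists>y. measure (uniform_c0 \<gamma>) (ball x \<delta>)
      \<le> 1 / 2 * measure (uniform_c0 \<gamma>) (ball y \<delta>)"
    by (rule eventually_frequently[rotated]) simp
qed (simp_all add: prob_space_uniform_c0)

text \<open>
  At radius \<open>\<gamma> n\<close> the recentred \<open>n\<close>-th factor is 1, while that of the half-way point is the probability
  of \<open>(-1/2, 1]\<close>. The competing centre changes with the radius.
\<close>

lemma not_strong_mode_half:
  fixes \<gamma> :: "nat \<Rightarrow> real" and x :: c0
  assumes lim: "\<gamma> \<longlonglongrightarrow> 0" and pos: "\<And>k. 0 < \<gamma> k" and x: "\<And>k. coord x k = \<gamma> k / 2"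
  shows "\<not> strong_mode (uniform_c0 \<gamma>) x"
proof (rule not_strong_modeI[of _ "3 / 4"])
  let ?P = "\<lambda>\<delta>. \<exists>y. measure (uniform_c0 \<gamma>) (ball x \<delta>) \<le> 3 / 4 * measure (uniform_c0 \<gamma>) (ball y \<delta>)"
  have P: "?P (\<gamma> n)" for n
    using measure_ball_recentre[of \<gamma> n "\<gamma> n" x] lim pos[of n]
    by (intro exI[of _ "x - coord x n *\<^sub>R unit_c0 n"]) (simp add: x)
  have "filterlim \<gamma> (at_right 0) sequentially"
    using lim pos by (intro tendsto_imp_filterlim_at_right) auto
  moreover have "\<exists>\<^sub>F n in sequentially. ?P (\<gamma> n)"
    using P by (intro eventually_frequently always_eventually) auto
  ultimately show "\<exists>\<^sub>F \<delta> in at_right 0. ?P \<delta>"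
    unfolding frequently_def filterlim_iff by blast
qed (simp_all add: prob_space_uniform_c0)

theorem proposition4p12:
  shows "(\<forall>\<gamma> :: nat \<Rightarrow> real. (\<forall>k. 0 \<le> \<gamma> k) \<longrightarrow> \<gamma> \<longlonglongrightarrow> 0 \<longrightarrow>
            (\<forall>x\<in>E_box \<gamma>. (\<exists>m. \<bar>coord x m\<bar> = \<gamma> m \<and> \<gamma> m > 0) \<longrightarrow> \<not> strong_mode (uniform_c0 \<gamma>) x))
       \<and> (\<exists>\<gamma> :: nat \<Rightarrow> real. (\<forall>k. 0 \<le> \<gamma> k) \<and> \<gamma> \<longlonglongrightarrow> 0 \<and>
            (\<exists>x :: c0. (\<forall>k. \<bar>coord x k\<bar> < \<gamma> k) \<and> \<not> strong_mode (uniform_c0 \<gamma>) x))"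
proof
  define \<gamma> :: "nat \<Rightarrow> real" where "\<gamma> k = inverse (real (Suc k))" for k
  have lim: "\<gamma> \<longlonglongrightarrow> 0"
    unfolding \<gamma>_def by (rule LIMSEQ_inverse_real_of_nat)
  have pos: "0 < \<gamma> k" for k
    by (simp add: \<gamma>_def)
  define x where "x = Abs_c0 (\<lambda>k. \<gamma> k / 2)"
  have x: "coord x k = \<gamma> k / 2" for k
    using tendsto_divide[OF lim tendsto_const[of 2]] by (simp add: x_def Abs_c0_inverse)
  have "\<bar>coord x k\<bar> < \<gamma> k" for k
    using pos[of k] by (simp add: x)
  then show "\<exists>\<gamma> :: nat \<Rightarrow> real. (\<forall>k. 0 \<le> \<gamma> k) \<and> \<gamma> \<longlonglongrightarrow> 0 \<and>
      (\<exists>x :: c0. (\<forall>k. \<bar>coord x k\<bar> < \<gamma> k) \<and> \<not> strong_mode (uniform_c0 \<gamma>) x)"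
    using lim not_strong_mode_half[OF lim pos x] less_imp_le[OF pos] by blast
qed (use not_strong_mode_face in blast)

end
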